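(* Let $G$ be a non-discrete totally disconnected locally compact second-countable group. Then $G$ is abstractly simple if and only if it has the following three properties: (S0) $G$ has no proper open normal subgroups. (S1) Every non-trivial normal subgroup of $G$ contains an infinite commensurated compact locally normal subgroup of $G$. (S2) Every infinite commensurated compact subgroup of $G$ is open. If $G$ is abstractly simple then the following stronger version of (S2) holds: suppose $U$ is an open subgroup of $G$, and $K$ is a normal subgroup of $U$ (not necessarily closed) that is commensurated by $G$. Then $K$ has countably many cosets in $G$ and $\overline{K}$ is an open subgroup of $G$.
   Context: A topological group is abstractly simple if it has no proper non-trivial normal subgroup (closed or not). A subgroup of a topological group $G$ is locally normal in $G$ if its normaliser in $G$ is open. A subgroup $K \le G$ is commensurated by $G$ if for every $g \in G$ the index $|K : K \cap gKg^{-1}|$ is finite.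
   Formalization: In the final claim, K is additionally required to be non-trivial; as worded the claim fails for the trivial subgroup K = {1} of U = G, which is normal and commensurated but whose closure is not open in a non-discrete G. *)

theory Defs
  imports "HOL-Analysis.Analysis" "HOL-Algebra.Group_Action" "HOL-Algebra.SimpleGroups"
begin

locale topological_group = group G for G (structure) +
  fixes T :: "'a topology"
  assumes topspace_eq_carrier: "topspace T = carrier G"
    and continuous_mult: "continuous_map (prod_topology T T) T (\<lambda>(x, y). x \<otimes> y)"
    and continuous_inv: "continuous_map T T (\<lambda>x. inv x)"

definition totally_disconnected_space :: "'a topology \<Rightarrow> bool" where
  "totally_disconnected_space T \<longleftrightarrow> (\<forall>x\<in>topspace T. connected_component_of_set T x = {x})"

text \<open>A totally disconnected topological group is automatically Hausdorff, so the Hausdorff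
  axiom is not part of the following locale.\<close>

locale tdlcsc_group = topological_group +
  assumes totally_disconnected: "totally_disconnected_space T"
    and locally_compact: "locally_compact_space T"
    and second_countable: "second_countable T"

text \<open>The library locale \<^locale>\<open>simple_group\<close> requires \<^term>\<open>order G > 1\<close>, which fails for every
  infinite group because \<^term>\<open>order G\<close> is then 0; it cannot be used here.\<close>

definition abstractly_simple :: "('a, 'b) monoid_scheme \<Rightarrow> bool" where
  "abstractly_simple G \<longleftrightarrow> (\<forall>N. N \<lhd> G \<longrightarrow> N = carrier G \<or> N = {\<one>\<^bsub>G\<^esub>})"

definition locally_normal :: "('a, 'b) monoid_scheme \<Rightarrow> 'a topology \<Rightarrow> 'a set \<Rightarrow> bool" where
  "locally_normal G T K \<longleftrightarrow> subgroup K G \<and> openin T (normalizer G K)"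

text \<open>The index \<open>|K : K \<inter> gKg\<inverse>|\<close> is finite iff the set of cosets is; \<^term>\<open>card\<close> would
  not distinguish an infinite index from 0.\<close>

definition commensurated :: "('a, 'b) monoid_scheme \<Rightarrow> 'a set \<Rightarrow> bool" where
  "commensurated G K \<longleftrightarrow> subgroup K G \<and>
     (\<forall>g\<in>carrier G.
        finite (rcosets\<^bsub>G\<lparr>carrier := K\<rparr>\<^esub> (K \<inter> (g <#\<^bsub>G\<^esub> K #>\<^bsub>G\<^esub> inv\<^bsub>G\<^esub> g))))"

end

theory Submission
  imports Defs "HOL-Algebra.Generated_Groups"
begin

text \<open>Let \<open>G\<close> be abstractly simple and let \<open>K \<noteq> {\<one>}\<close> be commensurated and normalised by an open
  subgroup. By second countability \<open>K\<close> has only countably many conjugates, and each of them lies in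
  finitely many cosets of \<open>K\<close>. Hence the normal closure of \<open>K\<close>, which is \<open>G\<close>, is a union of
  countably many cosets of \<open>K\<close>, and by Baire's theorem the closure of \<open>K\<close> is open. For (S2), where
  \<open>K\<close> is compact but not assumed locally normal, a second application of Baire's theorem yields a
  subgroup \<open>P\<close> of finite index in \<open>K\<close> that is normalised by an open subgroup; the closure of \<open>P\<close>
  is then open and contained in \<open>K\<close>. (S1) follows from van Dantzig's theorem. Conversely, under
  (S1) and (S2) every non-trivial normal subgroup is open, so that (S0) applies.\<close>

section \<open>Almost containment of subgroups\<close>

context group
begin

section \<open>Products, cosets and conjugates\<close>

lemma inv_cancel [simp]:
  assumes "x \<in> carrier G" "y \<in> carrier G"
  shows "inv x \<otimes> (x \<otimes> y) = y" "x \<otimes> (inv x \<otimes> y) = y"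
  using assms by (simp_all add: m_assoc [symmetric])

lemma mem_set_mult_iff: "x \<in> H <#> F \<longleftrightarrow> (\<exists>h\<in>H. \<exists>f\<in>F. x = h \<otimes> f)"
  by (auto simp: set_mult_def)

lemma set_mult_coverE:
  assumes "K \<subseteq> H <#> F" "k \<in> K"
  obtains h f where "h \<in> H" "f \<in> F" "k = h \<otimes> f"
  using assms by (auto simp: set_mult_def)

lemma mem_conjugate_iff:
  assumes "K \<subseteq> carrier G" "g \<in> carrier G" "x \<in> carrier G"
  shows "x \<in> g <# K #> inv g \<longleftrightarrow> inv g \<otimes> x \<otimes> g \<in> K"
proof
  assume "inv g \<otimes> x \<otimes> g \<in> K"
  moreover have "x = g \<otimes> (inv g \<otimes> x \<otimes> g) \<otimes> inv g"
    using assms by (simp add: m_assoc)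
  ultimately show "x \<in> g <# K #> inv g"
    unfolding l_coset_def r_coset_def by blast
next
  assume "x \<in> g <# K #> inv g"
  then obtain k where "k \<in> K" "x = g \<otimes> k \<otimes> inv g"
    by (auto simp: l_coset_def r_coset_def)
  moreover have "k \<in> carrier G"
    using assms \<open>k \<in> K\<close> by blast
  ultimately show "inv g \<otimes> x \<otimes> g \<in> K"
    using assms by (simp add: m_assoc)
qed

lemma conjugate_subset_carrier:
  "K \<subseteq> carrier G \<Longrightarrow> g \<in> carrier G \<Longrightarrow> g <# K #> inv g \<subseteq> carrier G"
  by (simp add: l_coset_subset_G r_coset_subset_G)

lemma subgroup_conjugate:
  assumes "subgroup K G" "g \<in> carrier G"
  shows "subgroup (g <# K #> inv g) G"
proof -
  interpret K: subgroup K G by fact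
  have sub: "g <# K #> inv g \<subseteq> carrier G"
    using assms by (simp add: conjugate_subset_carrier K.subset)
  show ?thesis
  proof (rule subgroupI [OF sub])
    have "\<one> \<in> g <# K #> inv g"
      using assms by (simp add: mem_conjugate_iff K.subset)
    then show "g <# K #> inv g \<noteq> {}" by blast
  next
    fix a assume a: "a \<in> g <# K #> inv g"
    then have aG: "a \<in> carrier G" using sub by blast
    have "inv (inv g \<otimes> a \<otimes> g) \<in> K"
      using a aG assms by (simp add: mem_conjugate_iff K.subset)
    then show "inv a \<in> g <# K #> inv g"
      using aG assms by (simp add: mem_conjugate_iff K.subset inv_mult_group m_assoc)
  next
    fix a b assume a: "a \<in> g <# K #> inv g" and b: "b \<in> g <# K #> inv g"
    then have G: "a \<in> carrier G" "b \<in> carrier G" using sub by auto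
    have "(inv g \<otimes> a \<otimes> g) \<otimes> (inv g \<otimes> b \<otimes> g) \<in> K"
      using a b G assms by (simp add: mem_conjugate_iff K.subset)
    then show "a \<otimes> b \<in> g <# K #> inv g"
      using G assms by (simp add: mem_conjugate_iff K.subset m_assoc)
  qed
qed

text \<open>For subgroups this encodes finite index of \<open>K \<inter> H\<close> in
  \<open>K\<close>, as a finite cover of \<open>K\<close> by right cosets of \<open>H\<close>. Such
  covers compose by multiplying the covering sets, without index arithmetic.\<close>

definition almost_sub :: "'a set \<Rightarrow> 'a set \<Rightarrow> bool" where
  "almost_sub K H \<longleftrightarrow> (\<exists>F. finite F \<and> F \<subseteq> carrier G \<and> K \<subseteq> H <#> F)"

lemma subset_imp_almost_sub:
  assumes "K \<subseteq> H" "H \<subseteq> carrier G"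
  shows "almost_sub K H"
proof -
  have "K \<subseteq> H <#> {\<one>}"
    using assms by (auto simp: mem_set_mult_iff subset_iff)
  then show ?thesis
    unfolding almost_sub_def by blast
qed

lemma almost_sub_trans:
  assumes "almost_sub K H" "almost_sub H L" "L \<subseteq> carrier G"
  shows "almost_sub K L"
proof -
  obtain F where F: "finite F" "F \<subseteq> carrier G" "K \<subseteq> H <#> F"
    using assms(1) by (auto simp: almost_sub_def)
  obtain E where E: "finite E" "E \<subseteq> carrier G" "H \<subseteq> L <#> E"
    using assms(2) by (auto simp: almost_sub_def)
  have "finite (E <#> F)"
    using E(1) F(1) by (simp add: set_mult_def)
  moreover have "E <#> F \<subseteq> carrier G"
    by (simp add: E F set_mult_closed)
  moreover have "K \<subseteq> L <#> (E <#> F)"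
    using F(3) mono_set_mult [OF E(3) order_refl, of G F] assms(3) E F
    by (simp add: set_mult_assoc)
  ultimately show ?thesis
    unfolding almost_sub_def by blast
qed

text \<open>If a coset of \<open>H\<close> and a coset of \<open>M\<close> meet, they meet in a
  single coset of \<open>H \<inter> M\<close>, and only finitely many pairs of cosets occur.\<close>

lemma almost_sub_Int:
  assumes "almost_sub K H" "almost_sub K M" "subgroup H G" "subgroup M G"
  shows "almost_sub K (H \<inter> M)"
proof -
  interpret H: subgroup H G by fact
  interpret M: subgroup M G by fact
  obtain F where F: "finite F" "F \<subseteq> carrier G" "K \<subseteq> H <#> F"
    using assms(1) by (auto simp: almost_sub_def)
  obtain E where E: "finite E" "E \<subseteq> carrier G" "K \<subseteq> M <#> E"
    using assms(2) by (auto simp: almost_sub_def)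
  \<comment> \<open>\<open>X p\<close> is the intersection of the two cosets indexed by
    \<open>p\<close>, and \<open>c p\<close> a point of it; \<open>P\<close> keeps the pairs for
    which there is one.\<close>
  define X where "X p = (H #> fst p) \<inter> (M #> snd p)" for p
  define c where "c p = (SOME x. x \<in> X p)" for p
  define P where "P = {p \<in> F \<times> E. X p \<noteq> {}}"
  have c: "c p \<in> X p" if "p \<in> P" for p
    using that unfolding c_def P_def by (simp add: some_in_eq)
  have XG: "X p \<subseteq> carrier G" if "p \<in> P" for p
    using that F(2) r_coset_subset_G [OF H.subset, of "fst p"] unfolding X_def P_def by fastforce
  have "finite (c ` P)"
    using E(1) F(1) by (simp add: P_def)
  moreover have "c ` P \<subseteq> carrier G"
    using c XG by blast
  moreover have "K \<subseteq> (H \<inter> M) <#> c ` P"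
  proof
    fix k assume "k \<in> K"
    then obtain h f m e where k: "h \<in> H" "f \<in> F" "k = h \<otimes> f" "m \<in> M" "e \<in> E" "k = m \<otimes> e"
      using F(3) E(3) by (metis set_mult_coverE)
    then have kX: "k \<in> X (f, e)"
      using k(1,3,4,6) unfolding X_def r_coset_def fst_conv snd_conv by blast
    then have p: "(f, e) \<in> P"
      using k by (auto simp: P_def)
    obtain h' m' where c': "h' \<in> H" "c (f, e) = h' \<otimes> f" "m' \<in> M" "c (f, e) = m' \<otimes> e"
      using c [OF p] by (auto simp: X_def r_coset_def)
    have G: "f \<in> carrier G" "e \<in> carrier G"
      using F E k by auto
    \<comment> \<open>Since \<open>k\<close> and \<open>c (f, e)\<close> lie in the same two cosets,
      cancelling \<open>f\<close> puts their quotient in \<open>H\<close>, and cancelling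
      \<open>e\<close> puts it in \<open>M\<close>.\<close>
    have "k \<otimes> inv (c (f, e)) = h \<otimes> inv h'"
      unfolding c'(2) k(3) using G k(1) c'(1) by (simp add: inv_mult_group m_assoc)
    moreover have "k \<otimes> inv (c (f, e)) = m \<otimes> inv m'"
      unfolding c'(4) k(6) using G k(4) c'(3) by (simp add: inv_mult_group m_assoc)
    ultimately have "k \<otimes> inv (c (f, e)) \<in> H \<inter> M"
      using k c' by (metis H.m_closed H.m_inv_closed IntI M.m_closed M.m_inv_closed)
    moreover have "k = (k \<otimes> inv (c (f, e))) \<otimes> c (f, e)"
      using XG [OF p] kX c [OF p] by (auto simp: m_assoc subset_iff)
    ultimately show "k \<in> (H \<inter> M) <#> c ` P"
      using p unfolding mem_set_mult_iff by blast
  qed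
  ultimately show ?thesis
    unfolding almost_sub_def by blast
qed

lemma almost_sub_conjugate:
  assumes "almost_sub K H" "K \<subseteq> carrier G" "H \<subseteq> carrier G" "g \<in> carrier G"
  shows "almost_sub (g <# K #> inv g) (g <# H #> inv g)"
proof -
  obtain F where F: "finite F" "F \<subseteq> carrier G" "K \<subseteq> H <#> F"
    using assms(1) by (auto simp: almost_sub_def)
  let ?F = "(\<lambda>f. g \<otimes> f \<otimes> inv g) ` F"
  have "g <# K #> inv g \<subseteq> (g <# H #> inv g) <#> ?F"
  proof
    fix x assume "x \<in> g <# K #> inv g"
    then obtain k where k: "k \<in> K" "x = g \<otimes> k \<otimes> inv g"
      by (auto simp: l_coset_def r_coset_def)
    then obtain h f where hf: "h \<in> H" "f \<in> F" "k = h \<otimes> f"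
      using F(3) by (blast elim: set_mult_coverE)
    then have "x = (g \<otimes> h \<otimes> inv g) \<otimes> (g \<otimes> f \<otimes> inv g)"
      using k assms F(2) by (simp add: m_assoc subset_iff)
    moreover have "g \<otimes> h \<otimes> inv g \<in> g <# H #> inv g"
      using hf by (auto simp: l_coset_def r_coset_def)
    ultimately show "x \<in> (g <# H #> inv g) <#> ?F"
      using hf unfolding mem_set_mult_iff by blast
  qed
  moreover have "finite ?F" "?F \<subseteq> carrier G"
    using F assms(4) by auto
  ultimately show ?thesis
    unfolding almost_sub_def by blast
qed

lemma rcos_mult_cancel:
  assumes "subgroup H G" "h \<in> H" "x \<in> carrier G"
  shows "H #> (h \<otimes> x) = H #> x"
  using assms by (metis coset_join2 coset_mult_assoc subgroup.mem_carrier subgroup.subset)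

text \<open>Bridge from the coset set in \<open>commensurated\<close> to covers. One representative
  per coset gives a cover; conversely, a cover by cosets of \<open>H\<close> is first refined to
  cosets of \<open>K \<inter> H\<close> by \<open>almost_sub_Int\<close>.\<close>

lemma finite_rcosets_Int_iff:
  assumes "subgroup K G" "subgroup H G"
  shows "finite (rcosets\<^bsub>G\<lparr>carrier := K\<rparr>\<^esub> (K \<inter> H)) \<longleftrightarrow> almost_sub K H"
proof -
  interpret K: subgroup K G by fact
  interpret H: subgroup H G by fact
  have KH: "subgroup (K \<inter> H) G"
    using assms by (rule subgroups_Inter_pair)
  have eq: "rcosets\<^bsub>G\<lparr>carrier := K\<rparr>\<^esub> (K \<inter> H) = (\<lambda>k. (K \<inter> H) #> k) ` K"
    by (auto simp: RCOSETS_def)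
  show ?thesis
  proof
    define r where "r k = (K \<inter> H) #> k" for k
    assume "finite (rcosets\<^bsub>G\<lparr>carrier := K\<rparr>\<^esub> (K \<inter> H))"
    then have fin: "finite (r ` K)"
      by (simp add: eq r_def)
    define F where "F = inv_into K r ` r ` K"
    have F: "F \<subseteq> K" "finite F"
      using fin by (auto simp: F_def inv_into_into)
    have "K \<subseteq> H <#> F"
    proof
      fix k assume k: "k \<in> K"
      define f where "f = inv_into K r (r k)"
      have f: "f \<in> F" "(K \<inter> H) #> k = (K \<inter> H) #> f"
        using k f_inv_into_f [of "r k" r K] by (simp_all add: F_def f_def flip: r_def)
      have "k \<in> (K \<inter> H) #> k"
        using k KH by (simp add: rcos_self)
      then have "k \<in> (K \<inter> H) #> f"
        using f by simp
      then show "k \<in> H <#> F"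
        using f(1) by (auto simp: r_coset_def set_mult_def)
    qed
    then show "almost_sub K H"
      unfolding almost_sub_def using F K.subset by blast
  next
    assume "almost_sub K H"
    then have "almost_sub K (K \<inter> H)"
      using assms by (simp add: almost_sub_Int subset_imp_almost_sub K.subset)
    then obtain F where F: "finite F" "F \<subseteq> carrier G" "K \<subseteq> (K \<inter> H) <#> F"
      by (auto simp: almost_sub_def)
    have "(K \<inter> H) #> k \<in> (\<lambda>f. (K \<inter> H) #> f) ` F" if k: "k \<in> K" for k
    proof -
      obtain h f where "h \<in> K \<inter> H" "f \<in> F" "k = h \<otimes> f"
        using F(3) k by (blast elim: set_mult_coverE)
      then show ?thesis
        using F(2) rcos_mult_cancel [OF KH, of h f] by auto
    qed
    then have "rcosets\<^bsub>G\<lparr>carrier := K\<rparr>\<^esub> (K \<inter> H) \<subseteq> (\<lambda>f. (K \<inter> H) #> f) ` F"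
      unfolding eq by blast
    then show "finite (rcosets\<^bsub>G\<lparr>carrier := K\<rparr>\<^esub> (K \<inter> H))"
      using F(1) by (meson finite_imageI finite_subset)
  qed
qed

section \<open>Commensurated subgroups\<close>

lemma commensurated_iff:
  "commensurated G K \<longleftrightarrow>
     subgroup K G \<and> (\<forall>g\<in>carrier G. almost_sub K (g <# K #> inv g))"
  unfolding commensurated_def by (simp add: finite_rcosets_Int_iff subgroup_conjugate cong: conj_cong)

text \<open>Conjugation by \<open>inv g\<close> gives a cover of \<open>K\<close> by finitely many
  cosets of \<open>inv g K g\<close>; multiplying by \<open>g\<close> on the left turns it into a
  cover of \<open>g K\<close> by cosets of \<open>K\<close>.\<close>

lemma commensurated_l_coset_covered:
  assumes "commensurated G K" "g \<in> carrier G"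
  shows "\<exists>F. finite F \<and> F \<subseteq> carrier G \<and> g <# K \<subseteq> K <#> F"
proof -
  have sub: "K \<subseteq> carrier G"
    using assms by (simp add: commensurated_def subgroup.subset)
  have "almost_sub K (inv g <# K #> inv (inv g))"
    using assms commensurated_iff inv_closed by blast
  then obtain F where F: "finite F" "F \<subseteq> carrier G" "K \<subseteq> (inv g <# K #> g) <#> F"
    using assms(2) by (auto simp: almost_sub_def)
  have "g <# K \<subseteq> K <#> ((\<lambda>f. g \<otimes> f) ` F)"
  proof
    fix x assume "x \<in> g <# K"
    then obtain k where k: "k \<in> K" "x = g \<otimes> k"
      by (auto simp: l_coset_def)
    then obtain l f where "l \<in> K" "f \<in> F" "k = inv g \<otimes> l \<otimes> g \<otimes> f"
      using set_mult_coverE [OF F(3) k(1)] unfolding l_coset_def r_coset_def by blast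
    moreover have "l \<in> carrier G" "f \<in> carrier G"
      using calculation sub F by auto
    ultimately show "x \<in> K <#> ((\<lambda>f. g \<otimes> f) ` F)"
      using k assms(2) by (auto simp: mem_set_mult_iff m_assoc)
  qed
  moreover have "(\<lambda>f. g \<otimes> f) ` F \<subseteq> carrier G"
    using F assms by auto
  ultimately show ?thesis
    using F(1) by blast
qed

text \<open>\<open>P\<close> lies in \<open>K\<close>, \<open>K\<close> almost in its conjugate by
  \<open>g\<close>, and that conjugate almost in the conjugate of \<open>P\<close>.\<close>

lemma commensurated_almost_sub:
  assumes "commensurated G K" "subgroup P G" "P \<subseteq> K" "almost_sub K P"
  shows "commensurated G P"
proof -
  interpret P: subgroup P G by fact
  have KG: "K \<subseteq> carrier G"
    using assms(1) by (simp add: commensurated_def subgroup.subset)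
  have "almost_sub P (g <# P #> inv g)" if g: "g \<in> carrier G" for g
  proof -
    have "almost_sub P K"
      using assms(3) KG by (rule subset_imp_almost_sub)
    moreover have "almost_sub K (g <# K #> inv g)"
      using assms(1) g by (simp add: commensurated_iff)
    moreover have "almost_sub (g <# K #> inv g) (g <# P #> inv g)"
      using assms(4) KG P.subset g by (rule almost_sub_conjugate)
    ultimately show ?thesis
      using KG P.subset g conjugate_subset_carrier almost_sub_trans by meson
  qed
  then show ?thesis
    using assms(2) by (simp add: commensurated_iff)
qed

section \<open>Countable covers by cosets\<close>

lemma countable_set_mult: "countable A \<Longrightarrow> countable B \<Longrightarrow> countable (A <#> B)"
  by (simp add: set_mult_def)

text \<open>With \<open>g K \<subseteq> K F(g)\<close> and \<open>E\<close> the union of the iterates of \<open>A \<mapsto> (\<Union>e\<in>A. F(e)) E0\<close> starting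
  from \<open>{\<one>}\<close>, right translation by elements of \<open>S\<close> preserves \<open>K E\<close>.\<close>

lemma generate_countably_covered:
  assumes K: "commensurated G K"
    and S: "S \<subseteq> carrier G" "\<And>x. x \<in> S \<Longrightarrow> inv x \<in> S"
    and E0: "countable E0" "E0 \<subseteq> carrier G" "S \<subseteq> K <#> E0"
  shows "\<exists>E. countable E \<and> E \<subseteq> carrier G \<and> generate G S \<subseteq> K <#> E"
proof -
  interpret K: subgroup K G
    using K by (simp add: commensurated_def)
  obtain F where F: "\<And>g. g \<in> carrier G \<Longrightarrow> finite (F g) \<and> F g \<subseteq> carrier G \<and> g <# K \<subseteq> K <#> F g"
    using commensurated_l_coset_covered [OF K] by metis
  define D where "D = rec_nat {\<one>} (\<lambda>_ A. (\<Union>e\<in>A. F e) <#> E0)"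
  have D0: "D 0 = {\<one>}" and DSuc: "\<And>n. D (Suc n) = (\<Union>e\<in>D n. F e) <#> E0"
    by (simp_all add: D_def)
  have D: "countable (D n) \<and> D n \<subseteq> carrier G" for n
  proof (induction n)
    case (Suc n)
    have "(\<Union>e\<in>D n. F e) \<subseteq> carrier G"
      using Suc F by blast
    moreover have "countable (\<Union>e\<in>D n. F e)"
    proof (rule countable_UN)
      fix e assume "e \<in> D n"
      then show "countable (F e)"
        using Suc F [of e] by (simp add: subset_iff countable_finite)
    qed (use Suc in simp)
    ultimately show ?case
      unfolding DSuc using E0 by (simp add: countable_set_mult set_mult_closed)
  qed (simp add: D0)
  define E where "E = (\<Union>n. D n)"
  have E: "countable E" "E \<subseteq> carrier G" "\<one> \<in> E"
    unfolding E_def using D D0 by auto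
  \<comment> \<open>Writing \<open>y = k e\<close> and \<open>s = l d\<close>, commensuration moves
    \<open>e\<close> past \<open>l\<close>, at the cost of replacing it by some \<open>f\<close> in
    the finite set \<open>F e\<close>.\<close>
  have step: "y \<otimes> s \<in> K <#> E" if y: "y \<in> K <#> E" and s: "s \<in> S" for y s
  proof -
    obtain k e where "k \<in> K" "e \<in> E" "y = k \<otimes> e"
      using y by (rule set_mult_coverE [OF order_refl])
    then obtain n where ke: "k \<in> K" "e \<in> D n" "y = k \<otimes> e"
      by (auto simp: E_def)
    obtain l d where ld: "l \<in> K" "d \<in> E0" "s = l \<otimes> d"
      using s E0(3) by (blast elim: set_mult_coverE)
    have e: "e \<in> carrier G"
      using D ke by blast
    then have "e \<otimes> l \<in> K <#> F e"
      using F ld(1) by (auto simp: l_coset_def subset_iff)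
    then obtain m f where mf: "m \<in> K" "f \<in> F e" "e \<otimes> l = m \<otimes> f"
      by (auto simp: mem_set_mult_iff)
    have G: "f \<in> carrier G" "d \<in> carrier G"
      using mf F e ld E0 by auto
    have "y \<otimes> s = k \<otimes> (e \<otimes> l) \<otimes> d"
      using ke ld e G by (simp add: m_assoc)
    also have "\<dots> = (k \<otimes> m) \<otimes> (f \<otimes> d)"
      using ke mf ld e G by (simp add: m_assoc)
    finally have "y \<otimes> s = (k \<otimes> m) \<otimes> (f \<otimes> d)" .
    moreover have "f \<otimes> d \<in> D (Suc n)"
      unfolding DSuc using mf ke ld by (auto simp: mem_set_mult_iff)
    ultimately show ?thesis
      using ke mf by (auto simp: mem_set_mult_iff E_def)
  qed
  have sub: "K <#> E \<subseteq> carrier G"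
    using E(2) K.subset by (rule set_mult_closed [rotated])
  \<comment> \<open>Since \<open>y\<close> is arbitrary in the induction, a product
    \<open>x1 x2\<close> is handled by using the second hypothesis at \<open>y x1\<close>. Inverses
    of generators fall under \<open>step\<close> because \<open>S\<close> is closed under
    inversion.\<close>
  have "y \<otimes> x \<in> K <#> E" if "x \<in> generate G S" "y \<in> K <#> E" for x y
    using that
  proof (induction arbitrary: y rule: generate.induct)
    case one
    then show ?case using sub by auto
  next
    case (eng x1 x2)
    have "x1 \<in> carrier G" "x2 \<in> carrier G" "y \<in> carrier G"
      using eng sub generate_in_carrier [OF S(1)] by auto
    then have "y \<otimes> (x1 \<otimes> x2) = y \<otimes> x1 \<otimes> x2"
      by (simp add: m_assoc)
    then show ?case
      using eng by simp
  qed (use step S in auto)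
  moreover have "\<one> \<in> K <#> E"
    unfolding mem_set_mult_iff using E(3) K.one_closed by (intro bexI [of _ \<one>]) auto
  ultimately have "generate G S \<subseteq> K <#> E"
    using generate_in_carrier [OF S(1)] by fastforce
  then show ?thesis
    using E by blast
qed

end

section \<open>Topological groups\<close>

context topological_group
begin

section \<open>Continuity of the group operations and translates\<close>

lemma openin_subset_carrier: "openin T U \<Longrightarrow> U \<subseteq> carrier G"
  using openin_subset topspace_eq_carrier by blast

lemma continuous_map_mult:
  assumes "continuous_map X T f" "continuous_map X T g"
  shows "continuous_map X T (\<lambda>x. f x \<otimes> g x)"
  using continuous_map_compose [OF continuous_map_pairedI [OF assms] continuous_mult]
  by (simp add: o_def)

lemma continuous_map_inverse:
  "continuous_map X T f \<Longrightarrow> continuous_map X T (\<lambda>x. inv (f x))"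
  using continuous_map_compose [OF _ continuous_inv] by (simp add: o_def)

lemma continuous_map_const_carrier: "a \<in> carrier G \<Longrightarrow> continuous_map X T (\<lambda>x. a)"
  by (simp add: topspace_eq_carrier)

lemma continuous_map_identity: "continuous_map T T (\<lambda>x. x)"
  by (simp add: continuous_map_def)

lemmas continuous_group_intros =
  continuous_map_mult continuous_map_inverse continuous_map_const_carrier continuous_map_identity

lemma openin_preimage:
  "continuous_map T T f \<Longrightarrow> openin T U \<Longrightarrow> openin T {x \<in> carrier G. f x \<in> U}"
  using openin_continuous_map_preimage [of T T f U] by (simp add: topspace_eq_carrier)

lemma closedin_preimage:
  "continuous_map T T f \<Longrightarrow> closedin T U \<Longrightarrow> closedin T {x \<in> carrier G. f x \<in> U}"
  using closedin_continuous_map_preimage [of T T f U] by (simp add: topspace_eq_carrier)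

text \<open>Presents a translate as a preimage under right multiplication by \<open>inv a\<close>,
  so that openness and closedness carry over by continuity.\<close>

lemma r_coset_eq_preimage:
  assumes "U \<subseteq> carrier G" "a \<in> carrier G"
  shows "U #> a = {x \<in> carrier G. x \<otimes> inv a \<in> U}"
proof -
  have "x \<in> U #> a" if "x \<in> carrier G" "x \<otimes> inv a \<in> U" for x
  proof -
    have "x = (x \<otimes> inv a) \<otimes> a"
      using assms that by (simp add: m_assoc)
    then show ?thesis
      using that unfolding r_coset_def by blast
  qed
  moreover have "x \<in> carrier G \<and> x \<otimes> inv a \<in> U" if "x \<in> U #> a" for x
    using assms that by (auto simp: r_coset_def m_assoc subset_iff)
  ultimately show ?thesis by blast
qed

lemma openin_r_coset:
  assumes "openin T U" "a \<in> carrier G"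
  shows "openin T (U #> a)"
  unfolding r_coset_eq_preimage [OF openin_subset_carrier [OF assms(1)] assms(2)]
  by (intro openin_preimage continuous_group_intros assms inv_closed)

lemma closedin_r_coset:
  assumes "closedin T C" "a \<in> carrier G"
  shows "closedin T (C #> a)"
proof -
  have "C \<subseteq> carrier G"
    using closedin_subset [OF assms(1)] topspace_eq_carrier by simp
  then show ?thesis
    unfolding r_coset_eq_preimage [OF \<open>C \<subseteq> carrier G\<close> assms(2)]
    by (intro closedin_preimage continuous_group_intros assms inv_closed)
qed

lemma openin_conjugate:
  assumes "openin T U" "g \<in> carrier G"
  shows "openin T (g <# U #> inv g)"
proof -
  have sub: "U \<subseteq> carrier G"
    using assms openin_subset_carrier by blast
  have "g <# U #> inv g = {x \<in> carrier G. inv g \<otimes> x \<otimes> g \<in> U}"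
    using conjugate_subset_carrier [OF sub assms(2)] mem_conjugate_iff [OF sub assms(2)] by blast
  then show ?thesis
    by (auto intro!: openin_preimage continuous_group_intros assms)
qed

lemma closedin_conjugate:
  assumes "closedin T C" "g \<in> carrier G"
  shows "closedin T (g <# C #> inv g)"
proof -
  have sub: "C \<subseteq> carrier G"
    using closedin_subset [OF assms(1)] topspace_eq_carrier by simp
  have "g <# C #> inv g = {x \<in> carrier G. inv g \<otimes> x \<otimes> g \<in> C}"
    using conjugate_subset_carrier [OF sub assms(2)] mem_conjugate_iff [OF sub assms(2)] by blast
  then show ?thesis
    by (auto intro!: closedin_preimage continuous_group_intros assms)
qed

text \<open>For \<open>u\<close> in \<open>U\<close>, the translate of \<open>U\<close> by
  \<open>inv u h\<close> is an open neighbourhood of \<open>h\<close> inside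
  \<open>H\<close>.\<close>

lemma subgroup_openin:
  assumes "subgroup H G" "openin T U" "U \<subseteq> H" "U \<noteq> {}"
  shows "openin T H"
proof -
  interpret H: subgroup H G by fact
  obtain u where u: "u \<in> U" using assms by blast
  have "\<exists>W. openin T W \<and> h \<in> W \<and> W \<subseteq> H" if h: "h \<in> H" for h
  proof (intro exI conjI)
    let ?W = "U #> (inv u \<otimes> h)"
    have a: "inv u \<otimes> h \<in> H"
      using h u assms by (meson H.m_closed H.m_inv_closed subsetD)
    show "openin T ?W"
      using a by (simp add: openin_r_coset assms)
    have "h = u \<otimes> (inv u \<otimes> h)"
      using h u assms by (simp add: subset_iff)
    then show "h \<in> ?W"
      using u unfolding r_coset_def by blast
    show "?W \<subseteq> H"
      using a assms by (auto simp: r_coset_def)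
  qed
  then show ?thesis
    by (subst openin_subopen) blast
qed

text \<open>The complement is a union of open cosets.\<close>

lemma open_subgroup_closedin:
  assumes "subgroup H G" "openin T H"
  shows "closedin T H"
proof -
  interpret H: subgroup H G by fact
  have "\<exists>W. openin T W \<and> y \<in> W \<and> W \<subseteq> carrier G - H" if y: "y \<in> carrier G - H" for y
  proof (intro exI conjI)
    show "openin T (H #> y)"
      using y assms by (simp add: openin_r_coset)
    show "y \<in> H #> y"
      using y by (simp add: rcos_self H.subgroup_axioms)
    have "h \<otimes> y \<notin> H" if "h \<in> H" for h
    proof
      assume "h \<otimes> y \<in> H"
      then have "inv h \<otimes> (h \<otimes> y) \<in> H"
        using that by blast
      then show False
        using y that by simp
    qed
    then show "H #> y \<subseteq> carrier G - H"
      using y by (auto simp: r_coset_def)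
  qed
  then have "openin T (carrier G - H)"
    by (subst openin_subopen) blast
  then show ?thesis
    by (simp add: closedin_def topspace_eq_carrier H.subset)
qed

text \<open>Each property is checked on \<open>H\<close> and extended by minimality of the closure.
  For products this takes two rounds: first the left factor stays in \<open>H\<close>, then it too
  ranges over the closure.\<close>

lemma subgroup_closure_of:
  assumes "subgroup H G"
  shows "subgroup (T closure_of H) G"
proof -
  interpret H: subgroup H G by fact
  let ?C = "T closure_of H"
  have HC: "H \<subseteq> ?C"
    by (simp add: closure_of_subset topspace_eq_carrier H.subset)
  have CG: "?C \<subseteq> carrier G"
    using closure_of_subset_topspace topspace_eq_carrier by metis
  have left: "x \<otimes> y \<in> ?C" if "x \<in> H" "y \<in> ?C" for x y
  proof -
    have "?C \<subseteq> {y \<in> carrier G. x \<otimes> y \<in> ?C}"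
    proof (rule closure_of_minimal)
      show "H \<subseteq> {y \<in> carrier G. x \<otimes> y \<in> ?C}"
        using HC H.m_closed [OF that(1)] H.subset by blast
      show "closedin T {y \<in> carrier G. x \<otimes> y \<in> ?C}"
        using that by (intro closedin_preimage continuous_group_intros) auto
    qed
    then show ?thesis using that by blast
  qed
  have mult: "x \<otimes> y \<in> ?C" if "x \<in> ?C" "y \<in> ?C" for x y
  proof -
    have "?C \<subseteq> {x \<in> carrier G. x \<otimes> y \<in> ?C}"
    proof (rule closure_of_minimal)
      show "H \<subseteq> {x \<in> carrier G. x \<otimes> y \<in> ?C}"
        using that left by auto
      show "closedin T {x \<in> carrier G. x \<otimes> y \<in> ?C}"
        using that CG by (intro closedin_preimage continuous_group_intros) auto
    qed
    then show ?thesis using that by blast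
  qed
  have "?C \<subseteq> {x \<in> carrier G. inv x \<in> ?C}"
  proof (rule closure_of_minimal)
    show "H \<subseteq> {x \<in> carrier G. inv x \<in> ?C}"
      using HC by auto
    show "closedin T {x \<in> carrier G. inv x \<in> ?C}"
      by (intro closedin_preimage continuous_group_intros) auto
  qed
  moreover have "?C \<noteq> {}"
    using HC H.one_closed by blast
  ultimately show ?thesis
    using mult CG by (intro subgroupI) blast+
qed

lemma openin_one_imp_discrete:
  assumes "openin T {\<one>}"
  shows "T = discrete_topology (carrier G)"
proof -
  have "openin T {x}" if "x \<in> carrier G" for x
    using openin_r_coset [OF assms that] that by (simp add: r_coset_def)
  then show ?thesis
    by (simp add: discrete_topology_unique topspace_eq_carrier eq_commute [of T])
qed

text \<open>The cosets of \<open>V\<close> are an open cover of \<open>K\<close>; a finite subcover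
  is the required almost containment.\<close>

lemma compact_almost_sub_open:
  assumes "compactin T K" "subgroup V G" "openin T V"
  shows "almost_sub K V"
proof -
  have KG: "K \<subseteq> carrier G"
    using assms(1) compactin_subset_topspace topspace_eq_carrier by metis
  have "\<exists>\<F>. finite \<F> \<and> \<F> \<subseteq> (\<lambda>k. V #> k) ` K \<and> K \<subseteq> \<Union>\<F>"
  proof (rule compactinD [OF assms(1)])
    show "openin T W" if "W \<in> (\<lambda>k. V #> k) ` K" for W
      using that KG assms(3) openin_r_coset by blast
    show "K \<subseteq> \<Union> ((\<lambda>k. V #> k) ` K)"
      using KG assms(2) rcos_self by blast
  qed
  then obtain F where "finite F" "F \<subseteq> K" "K \<subseteq> \<Union> ((\<lambda>k. V #> k) ` F)"
    by (metis finite_subset_image)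
  then have "K \<subseteq> V <#> F"
    unfolding r_coset_def set_mult_def by blast
  then show ?thesis
    unfolding almost_sub_def using \<open>finite F\<close> \<open>F \<subseteq> K\<close> KG by blast
qed

text \<open>A closed subgroup meeting \<open>K\<close> in a finite-index subgroup is open relative to \<open>K\<close>: remove
  the finitely many closed cosets that miss \<open>\<one>\<close>.\<close>

lemma almost_sub_closed_neighbourhood:
  assumes "almost_sub K H" "subgroup H G" "closedin T H"
  obtains O' where "openin T O'" "\<one> \<in> O'" "K \<inter> O' \<subseteq> H"
proof -
  interpret H: subgroup H G by fact
  obtain F where F: "finite F" "F \<subseteq> carrier G" "K \<subseteq> H <#> F"
    using assms(1) by (auto simp: almost_sub_def)
  define C where "C = (\<Union>f\<in>F - H. H #> f)"
  have "closedin T C"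
    unfolding C_def using F assms closedin_r_coset by (intro closedin_Union) auto
  then have "openin T (carrier G - C)"
    using topspace_eq_carrier by (metis openin_diff openin_topspace)
  moreover have "\<one> \<in> carrier G - C"
  proof -
    have "f \<in> H" if "h \<in> H" "f \<in> F" "h \<otimes> f = \<one>" for h f
      using that F(2) by (metis H.m_inv_closed H.mem_carrier inv_equality inv_inv subsetD)
    then show ?thesis
      unfolding C_def r_coset_def by (auto dest: sym)
  qed
  moreover have "K \<inter> (carrier G - C) \<subseteq> H"
  proof
    fix k assume k: "k \<in> K \<inter> (carrier G - C)"
    then obtain h f where "h \<in> H" "f \<in> F" "k = h \<otimes> f"
      using F(3) by (blast elim: set_mult_coverE)
    then show "k \<in> H"
      using k by (auto simp: C_def r_coset_def)
  qed
  ultimately show ?thesis using that by blast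
qed

text \<open>Each conjugate of \<open>K\<close> is again an open subgroup, so compactness of
  \<open>K\<close> applies to it.\<close>

lemma compact_open_subgroup_commensurated:
  assumes "subgroup K G" "compactin T K" "openin T K"
  shows "commensurated G K"
  unfolding commensurated_iff
  using assms by (simp add: compact_almost_sub_open subgroup_conjugate openin_conjugate)

text \<open>The normaliser is a subgroup containing the open set \<open>K\<close>.\<close>

lemma open_subgroup_locally_normal:
  assumes "subgroup K G" "openin T K"
  shows "locally_normal G T K"
proof -
  interpret K: subgroup K G by fact
  have "k <# K #> inv k = K" if "k \<in> K" for k
    using that by (metis K.m_inv_closed K.rcos_const K.subgroup_axioms is_group lcos_mult_one
        coset_join3 K.mem_carrier)
  then have "K \<subseteq> normalizer G K"
    using K.subset by (auto simp: normalizer_def stabilizer_def)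
  then have "openin T (normalizer G K)"
    using assms K.subset K.one_closed by (intro subgroup_openin [OF normalizer_imp_subgroup]) (auto dest: subgroup.one_closed)
  then show ?thesis
    using assms by (simp add: locally_normal_def)
qed

end

section \<open>Totally disconnected locally compact groups\<close>

context tdlcsc_group
begin

section \<open>Separation and compact open subgroups\<close>

lemma closedin_one: "closedin T {\<one>}"
  using closedin_connected_component_of [of T \<one>] totally_disconnected
  by (simp add: totally_disconnected_space_def topspace_eq_carrier)

text \<open>The diagonal is the preimage of the closed set \<open>{\<one>}\<close> under
  \<open>(x, y) \<mapsto> x \<otimes> inv y\<close>.\<close>

lemma Hausdorff: "Hausdorff_space T"
proof -
  have eqI: "x = y" if "x \<in> carrier G" "y \<in> carrier G" "x \<otimes> inv y = \<one>" for x y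
    using inv_equality [OF that(3)] that by simp
  have "continuous_map (prod_topology T T) T (\<lambda>p. fst p \<otimes> inv (snd p))"
    by (intro continuous_map_mult continuous_map_inverse continuous_map_fst continuous_map_snd)
  then have "closedin (prod_topology T T)
      {p \<in> topspace (prod_topology T T). fst p \<otimes> inv (snd p) \<in> {\<one>}}"
    using closedin_one by (rule closedin_continuous_map_preimage)
  moreover have "{p \<in> topspace (prod_topology T T). fst p \<otimes> inv (snd p) \<in> {\<one>}}
      = (\<lambda>x. (x, x)) ` topspace T"
    by (auto simp: topspace_eq_carrier image_iff dest: eqI)
  ultimately show ?thesis
    by (simp add: Hausdorff_space_closedin_diagonal)
qed

lemma regular: "regular_space T"
  using locally_compact_Hausdorff_imp_regular_space locally_compact Hausdorff by blast

text \<open>The component \<open>{\<one>}\<close> is compact, so a clopen set \<open>B\<close>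
  separates it from the complement of a neighbourhood \<open>I\<close> that lies in a compact
  \<open>C\<close>; then \<open>B\<close> is closed in \<open>C\<close>, hence compact.\<close>

lemma compact_open_neighbourhood:
  assumes "openin T W" "\<one> \<in> W"
  obtains B where "compactin T B" "openin T B" "\<one> \<in> B" "B \<subseteq> W"
proof -
  obtain I C where I: "openin T I" "compactin T C" "\<one> \<in> I" "I \<subseteq> C" "C \<subseteq> W"
    using locally_compact regular locally_compact_regular_space_neighbourhood_base [of T] assms
    unfolding neighbourhood_base_of by blast
  have "connected_component_of_set T \<one> = {\<one>}"
    using totally_disconnected by (simp add: totally_disconnected_space_def topspace_eq_carrier)
  then have "{\<one>} \<in> connected_components_of T"
    by (metis connected_component_in_connected_components_of one_closed topspace_eq_carrier)
  then have "separated_between T {\<one>} (topspace T - I)"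
    using I closedin_diff [OF closedin_topspace I(1)] by (intro separated_between_compact_connected_component locally_compact Hausdorff)
       (auto simp: disjnt_def topspace_eq_carrier)
  then obtain B where B: "closedin T B" "openin T B" "\<one> \<in> B" "topspace T - I \<subseteq> topspace T - B"
    unfolding separated_between by auto
  then have "B \<subseteq> I"
    using openin_subset by blast
  then have "compactin T B"
    using B I by (meson closed_compactin order_trans)
  then show ?thesis
    using that B I \<open>B \<subseteq> I\<close> by blast
qed

text \<open>Van Dantzig: the left stabiliser of a compact open neighbourhood \<open>B\<close> of \<open>\<one>\<close> is contained
  in \<open>B\<close>, and it is open by the tube lemma.\<close>

lemma compact_open_subgroup:
  assumes "openin T W" "\<one> \<in> W"
  obtains V where "subgroup V G" "openin T V" "compactin T V" "V \<subseteq> W"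
proof -
  obtain B where B: "compactin T B" "openin T B" "\<one> \<in> B" "B \<subseteq> W"
    using compact_open_neighbourhood [OF assms] .
  have BG: "B \<subseteq> carrier G"
    using B openin_subset_carrier by blast
  define V where "V = {x \<in> carrier G. (\<forall>b\<in>B. x \<otimes> b \<in> B) \<and> (\<forall>b\<in>B. inv x \<otimes> b \<in> B)}"
  have V: "subgroup V G"
  proof (rule subgroupI)
    show "V \<subseteq> carrier G" "V \<noteq> {}"
      using BG by (auto simp: V_def intro!: exI [of _ \<one>])
    show "inv a \<in> V" if "a \<in> V" for a
      using that by (auto simp: V_def)
    show "a \<otimes> b \<in> V" if "a \<in> V" "b \<in> V" for a b
      using that BG by (auto simp: V_def inv_mult_group m_assoc subset_iff)
  qed
  \<comment> \<open>Apply the stabiliser condition to the point \<open>\<one>\<close> of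
    \<open>B\<close>.\<close>
  have VB: "V \<subseteq> B"
    using B(3) by (force simp: V_def)
  \<comment> \<open>The preimage of \<open>B\<close> under multiplication is open and contains
    \<open>{\<one>} \<times> B\<close>, so it contains a tube \<open>X \<times> B\<close>.\<close>
  let ?N = "{p \<in> topspace (prod_topology T T). fst p \<otimes> snd p \<in> B}"
  have "continuous_map (prod_topology T T) T (\<lambda>p. fst p \<otimes> snd p)"
    by (intro continuous_map_mult continuous_map_fst continuous_map_snd)
  then have "openin (prod_topology T T) ?N"
    using B(2) by (rule openin_continuous_map_preimage)
  then have "\<exists>X Y. openin T X \<and> openin T Y \<and> \<one> \<in> X \<and> B \<subseteq> Y \<and> X \<times> Y \<subseteq> ?N"
    using B(1) by (rule tube_lemma_right) (use BG in \<open>auto simp: topspace_eq_carrier\<close>)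
  then obtain X where X: "openin T X" "\<one> \<in> X" "X \<times> B \<subseteq> ?N"
    by blast
  have XB: "x \<otimes> b \<in> B" if "x \<in> X" "b \<in> B" for x b
    using X(3) that by auto
  \<comment> \<open>Symmetrised, because membership in \<open>V\<close> constrains both
    \<open>x\<close> and \<open>inv x\<close>.\<close>
  let ?X = "X \<inter> {x \<in> carrier G. inv x \<in> X}"
  have "openin T ?X"
    using X by (intro openin_Int openin_preimage continuous_group_intros)
  moreover have "?X \<subseteq> V"
    using XB by (auto simp: V_def)
  moreover have "?X \<noteq> {}"
    using X(2) by auto
  ultimately have "openin T V"
    using V subgroup_openin by blast
  moreover have "compactin T V"
    using open_subgroup_closedin [OF V \<open>openin T V\<close>] VB B(1) closed_compactin by blast
  ultimately show ?thesis
    using that V VB B(4) by blast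
qed

section \<open>Baire category and countability\<close>

lemma Baire_cover:
  assumes "countable \<G>" "\<And>C. C \<in> \<G> \<Longrightarrow> closedin T C" "carrier G \<subseteq> \<Union>\<G>"
  obtains C O' where "C \<in> \<G>" "openin T O'" "O' \<noteq> {}" "O' \<subseteq> C"
proof -
  have "\<exists>C\<in>\<G>. T interior_of C \<noteq> {}"
  proof (rule ccontr)
    assume "\<not> ?thesis"
    \<comment> \<open>A countable union of closed sets with empty interior has empty interior, yet
      this one contains the whole group.\<close>
    then have "T interior_of \<Union>\<G> = {}"
      using assms locally_compact regular by (intro Baire_category_alt) auto
    moreover have "carrier G \<subseteq> T interior_of \<Union>\<G>"
      using assms(3) by (metis interior_of_maximal openin_topspace topspace_eq_carrier)
    ultimately show False
      using one_closed by blast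
  qed
  then show ?thesis
    using that interior_of_subset openin_interior_of by metis
qed

text \<open>One point from each non-empty basic open set gives a countable dense set, which meets
  every left coset of \<open>U\<close>.\<close>

lemma countable_open_subgroup_representatives:
  assumes "subgroup U G" "openin T U"
  obtains D where "countable D" "D \<subseteq> carrier G" "carrier G \<subseteq> D <#> U"
proof -
  interpret U: subgroup U G by fact
  obtain \<B> where \<B>: "countable \<B>" "\<And>V. V \<in> \<B> \<Longrightarrow> openin T V"
      "\<And>W x. openin T W \<Longrightarrow> x \<in> W \<Longrightarrow> \<exists>V\<in>\<B>. x \<in> V \<and> V \<subseteq> W"
    using second_countable unfolding second_countable_def by metis
  define D where "D = (\<lambda>V. SOME x. x \<in> V) ` (\<B> - {{}})"
  have D: "countable D" "D \<subseteq> carrier G"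
  proof -
    show "countable D"
      using \<B>(1) by (simp add: D_def)
    have "(SOME x. x \<in> V) \<in> carrier G" if "V \<in> \<B>" "V \<noteq> {}" for V
      using some_in_eq [of V] that openin_subset_carrier [OF \<B>(2)] by blast
    then show "D \<subseteq> carrier G"
      by (auto simp: D_def)
  qed
  moreover have "g \<in> D <#> U" if g: "g \<in> carrier G" for g
  proof -
    \<comment> \<open>This set is the coset \<open>g U\<close>, written as a preimage to see that it
      is open.\<close>
    have "openin T {x \<in> carrier G. inv x \<otimes> g \<in> U}"
      using g assms by (intro openin_preimage continuous_group_intros)
    then obtain V where V: "V \<in> \<B>" "g \<in> V" "V \<subseteq> {x \<in> carrier G. inv x \<otimes> g \<in> U}"
      using \<B>(3) [of _ g] g by force
    then have d: "(SOME x. x \<in> V) \<in> V"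
      by (auto intro: someI)
    then have "(SOME x. x \<in> V) \<in> D"
      using V by (auto simp: D_def)
    moreover have "g = (SOME x. x \<in> V) \<otimes> (inv (SOME x. x \<in> V) \<otimes> g)"
      using V d g by auto
    ultimately show ?thesis
      using V d unfolding mem_set_mult_iff by blast
  qed
  ultimately show ?thesis
    using that by blast
qed

text \<open>The conjugates of \<open>K\<close> form a countable family, so the normal subgroup they generate, which
  is \<open>G\<close>, is covered by countably many cosets of \<open>K\<close>; now apply Baire's theorem.\<close>

lemma simple_commensurated_closure_open:
  assumes "abstractly_simple G"
    and U: "subgroup U G" "openin T U"
    and K: "commensurated G K" "K \<noteq> {\<one>}"
    and UK: "\<And>u k. u \<in> U \<Longrightarrow> k \<in> K \<Longrightarrow> u \<otimes> k \<otimes> inv u \<in> K"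
  shows "countable (rcosets K) \<and> openin T (T closure_of K)"
proof -
  interpret K: subgroup K G
    using K by (simp add: commensurated_def)
  obtain D where D: "countable D" "D \<subseteq> carrier G" "carrier G \<subseteq> D <#> U"
    using countable_open_subgroup_representatives [OF U] .
  define S where "S = {g \<otimes> k \<otimes> inv g |g k. g \<in> carrier G \<and> k \<in> K}"
  have SG: "S \<subseteq> carrier G"
    by (auto simp: S_def)
  have S_inv: "inv x \<in> S" if "x \<in> S" for x
  proof -
    obtain g k where "g \<in> carrier G" "k \<in> K" "x = g \<otimes> k \<otimes> inv g"
      using \<open>x \<in> S\<close> by (auto simp: S_def)
    then have "inv x = g \<otimes> inv k \<otimes> inv g"
      by (simp add: inv_mult_group m_assoc)
    then show ?thesis
      using \<open>g \<in> carrier G\<close> \<open>k \<in> K\<close> by (auto simp: S_def)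
  qed
  have S_conj: "g \<otimes> x \<otimes> inv g \<in> S" if "x \<in> S" "g \<in> carrier G" for x g
  proof -
    obtain h k where "h \<in> carrier G" "k \<in> K" "x = h \<otimes> k \<otimes> inv h"
      using \<open>x \<in> S\<close> by (auto simp: S_def)
    then have "g \<otimes> x \<otimes> inv g = (g \<otimes> h) \<otimes> k \<otimes> inv (g \<otimes> h)"
      using that by (simp add: inv_mult_group m_assoc)
    then show ?thesis
      using \<open>h \<in> carrier G\<close> \<open>k \<in> K\<close> that by (auto simp: S_def)
  qed
  have KS: "K \<subseteq> S"
  proof
    fix k assume "k \<in> K"
    then have "k = \<one> \<otimes> k \<otimes> inv \<one>" by simp
    then show "k \<in> S"
      using \<open>k \<in> K\<close> unfolding S_def by blast
  qed
  have "generate G S \<noteq> {\<one>}"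
    using KS K(2) K.one_closed by (auto dest: generate.incl)
  moreover have "generate G S \<lhd> G"
    using SG S_conj by (rule normal_generateI)
  ultimately have gen: "generate G S = carrier G"
    using assms(1) by (auto simp: abstractly_simple_def)
  obtain F where F: "\<And>g. g \<in> carrier G \<Longrightarrow> finite (F g) \<and> F g \<subseteq> carrier G \<and> g <# K \<subseteq> K <#> F g"
    using commensurated_l_coset_covered [OF K(1)] by metis
  \<comment> \<open>For \<open>g = d u\<close> the conjugate of \<open>k\<close> by \<open>g\<close>
    is \<open>d l (inv d)\<close> with \<open>l = u k (inv u)\<close> in \<open>K\<close>. As
    \<open>d l\<close> lies in \<open>K (F d)\<close>, the factors \<open>f (inv d)\<close> cover
    all of \<open>S\<close>.\<close>
  define E0 where "E0 = (\<Union>d\<in>D. (\<lambda>f. f \<otimes> inv d) ` F d)"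
  have FG: "f \<in> carrier G" if "d \<in> D" "f \<in> F d" for d f
    using F [of d] D(2) that by blast
  have "countable E0"
    unfolding E0_def using D F by (intro countable_UN countable_image) (auto intro: countable_finite)
  moreover have "E0 \<subseteq> carrier G"
    using FG D(2) by (auto simp: E0_def subset_iff)
  moreover have "S \<subseteq> K <#> E0"
  proof
    fix x assume "x \<in> S"
    then obtain g k where gk: "g \<in> carrier G" "k \<in> K" "x = g \<otimes> k \<otimes> inv g"
      by (auto simp: S_def)
    then obtain d u where du: "d \<in> D" "u \<in> U" "g = d \<otimes> u"
      using D(3) by (blast elim: set_mult_coverE)
    have G: "d \<in> carrier G" "u \<in> carrier G"
      using du D(2) subgroup.mem_carrier [OF U(1)] by auto
    define l where "l = u \<otimes> k \<otimes> inv u"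
    have l: "l \<in> K"
      using UK du gk by (simp add: l_def)
    have x: "x = (d \<otimes> l) \<otimes> inv d"
      using gk du G by (simp add: l_def inv_mult_group m_assoc)
    have "d \<otimes> l \<in> K <#> F d"
      using F [OF G(1)] l by (auto simp: l_coset_def)
    then obtain m f where mf: "m \<in> K" "f \<in> F d" "d \<otimes> l = m \<otimes> f"
      by (auto simp: mem_set_mult_iff)
    moreover have "f \<in> carrier G"
      using mf du FG by blast
    ultimately have "x = m \<otimes> (f \<otimes> inv d)"
      using x G by (simp add: m_assoc)
    then show "x \<in> K <#> E0"
      using mf du by (auto simp: mem_set_mult_iff E0_def)
  qed
  ultimately obtain E where E: "countable E" "E \<subseteq> carrier G" "carrier G \<subseteq> K <#> E"
    using generate_countably_covered [OF K(1) SG S_inv, of E0] gen by auto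
  have "K #> g \<in> (\<lambda>e. K #> e) ` E" if g: "g \<in> carrier G" for g
  proof -
    obtain k e where "k \<in> K" "e \<in> E" "g = k \<otimes> e"
      using E(3) g by (blast elim: set_mult_coverE)
    then show ?thesis
      using rcos_mult_cancel [OF K.subgroup_axioms, of k e] E(2) by auto
  qed
  then have "rcosets K \<subseteq> (\<lambda>e. K #> e) ` E"
    by (auto simp: RCOSETS_def)
  then have "countable (rcosets K)"
    using E(1) by (meson countable_image countable_subset)
  moreover
  let ?C = "T closure_of K"
  have KC: "K \<subseteq> ?C"
    by (simp add: closure_of_subset topspace_eq_carrier K.subset)
  \<comment> \<open>Passing to the closure makes the countably many cosets closed. The one with
    interior is translated back by \<open>inv e\<close> below.\<close>
  obtain C O' where C: "C \<in> (\<lambda>e. ?C #> e) ` E" "openin T O'" "O' \<noteq> {}" "O' \<subseteq> C"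
  proof (rule Baire_cover)
    show "countable ((\<lambda>e. ?C #> e) ` E)"
      using E(1) by simp
    show "closedin T C" if "C \<in> (\<lambda>e. ?C #> e) ` E" for C
      using that E(2) by (auto intro!: closedin_r_coset)
    show "carrier G \<subseteq> \<Union> ((\<lambda>e. ?C #> e) ` E)"
    proof
      fix g assume "g \<in> carrier G"
      then obtain k e where "k \<in> K" "e \<in> E" "g = k \<otimes> e"
        using E(3) by (blast elim: set_mult_coverE)
      then show "g \<in> \<Union> ((\<lambda>e. ?C #> e) ` E)"
        using KC by (auto simp: r_coset_def)
    qed
  qed
  then obtain e where e: "e \<in> E" "C = ?C #> e"
    by blast
  have "openin T ?C"
  proof (rule subgroup_openin)
    show "subgroup ?C G"
      by (simp add: subgroup_closure_of K.subgroup_axioms)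
    show "openin T (O' #> inv e)"
      using C e E(2) by (intro openin_r_coset) auto
    have CG: "?C \<subseteq> carrier G"
      using closure_of_subset_topspace topspace_eq_carrier by metis
    show "O' #> inv e \<subseteq> ?C"
    proof
      fix x assume "x \<in> O' #> inv e"
      then obtain c where "c \<in> ?C" "x = c \<otimes> e \<otimes> inv e"
        using C(4) e by (auto simp: r_coset_def)
      then show "x \<in> ?C"
        using CG e E(2) by (auto simp: m_assoc subset_iff)
    qed
    show "O' #> inv e \<noteq> {}"
      using C(3) by (auto simp: r_coset_def)
  qed
  ultimately show ?thesis
    by blast
qed

text \<open>By Baire, one of the countably many closed sets \<open>{g. g\<inverse> (K \<inter> V) g \<subseteq> K}\<close>, with \<open>V\<close> in a
  base of open subgroups, contains a coset \<open>a W\<close> of an open subgroup; the conjugates of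
  \<open>a\<inverse> (K \<inter> V) a\<close> under \<open>W\<close> then generate the required subgroup.\<close>

lemma compact_commensurated_almost_locally_normal:
  assumes K: "commensurated G K" "compactin T K"
  obtains P W where "subgroup P G" "P \<subseteq> K" "almost_sub K P" "subgroup W G" "openin T W"
    "\<And>w p. w \<in> W \<Longrightarrow> p \<in> P \<Longrightarrow> w \<otimes> p \<otimes> inv w \<in> P"
proof -
  interpret K: subgroup K G
    using K by (simp add: commensurated_def)
  have closedK: "closedin T K"
    using K(2) Hausdorff compactin_imp_closedin by blast
  obtain \<B> where \<B>: "countable \<B>" "\<And>V. V \<in> \<B> \<Longrightarrow> openin T V"
      "\<And>W x. openin T W \<Longrightarrow> x \<in> W \<Longrightarrow> \<exists>V\<in>\<B>. x \<in> V \<and> V \<subseteq> W"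
    using second_countable unfolding second_countable_def by metis
  \<comment> \<open>Shrinking each basic neighbourhood of \<open>\<one>\<close> to an open subgroup
    gives a countable neighbourhood base at \<open>\<one>\<close> of open subgroups.\<close>
  have "\<exists>V. subgroup V G \<and> openin T V \<and> V \<subseteq> B" if "B \<in> \<B>" "\<one> \<in> B" for B
    using compact_open_subgroup [OF \<B>(2) [OF that(1)] that(2)] by metis
  then obtain V where V: "\<And>B. B \<in> \<B> \<Longrightarrow> \<one> \<in> B \<Longrightarrow> subgroup (V B) G \<and> openin T (V B) \<and> V B \<subseteq> B"
    by metis
  define A where "A B = {g \<in> carrier G. \<forall>k\<in>K \<inter> V B. inv g \<otimes> k \<otimes> g \<in> K}" for B
  let ?\<B> = "{B \<in> \<B>. \<one> \<in> B}"
  obtain C O' where C: "C \<in> A ` ?\<B>" "openin T O'" "O' \<noteq> {}" "O' \<subseteq> C"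
  proof (rule Baire_cover)
    show "countable (A ` ?\<B>)"
      using \<B>(1) by (intro countable_image) (auto intro: countable_subset)
    show "closedin T C" if C: "C \<in> A ` ?\<B>" for C
    proof -
      obtain B where B: "B \<in> ?\<B>" "C = A B" using C by auto
      \<comment> \<open>Needed because an intersection over an empty index set would be the whole
        type rather than \<open>carrier G\<close>.\<close>
      have "K \<inter> V B \<noteq> {}"
        using V [of B] B K.one_closed subgroup.one_closed by blast
      moreover have "A B = (\<Inter>k\<in>K \<inter> V B. {g \<in> carrier G. inv g \<otimes> k \<otimes> g \<in> K})"
        using calculation by (auto simp: A_def)
      moreover have "closedin T {g \<in> carrier G. inv g \<otimes> k \<otimes> g \<in> K}" if "k \<in> K" for k
        using that closedK by (intro closedin_preimage continuous_group_intros) auto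
      ultimately show ?thesis
        using B by (auto intro!: closedin_Inter)
    qed
    show "carrier G \<subseteq> \<Union> (A ` ?\<B>)"
    proof
      fix g assume g: "g \<in> carrier G"
      \<comment> \<open>Near \<open>\<one>\<close>, \<open>K\<close> lies inside its conjugate by
        \<open>g\<close>, so a small enough \<open>V B\<close> puts \<open>g\<close> into
        \<open>A B\<close>.\<close>
      obtain O' where O': "openin T O'" "\<one> \<in> O'" "K \<inter> O' \<subseteq> g <# K #> inv g"
      proof (rule almost_sub_closed_neighbourhood)
        show "almost_sub K (g <# K #> inv g)"
          using K g by (simp add: commensurated_iff)
      qed (use g closedK in \<open>auto simp: subgroup_conjugate closedin_conjugate K.subgroup_axioms\<close>)
      obtain B where B: "B \<in> \<B>" "\<one> \<in> B" "B \<subseteq> O'"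
        using \<B>(3) O' by blast
      have "inv g \<otimes> k \<otimes> g \<in> K" if "k \<in> K \<inter> V B" for k
        using that V [OF B(1,2)] B(3) O'(3) g mem_conjugate_iff [of K g k] K.subset by blast
      then show "g \<in> \<Union> (A ` ?\<B>)"
        using B g by (auto simp: A_def)
    qed
  qed
  then obtain B where B: "B \<in> \<B>" "\<one> \<in> B" "O' \<subseteq> A B"
    by blast
  note VB = V [OF B(1,2)]
  obtain a where a: "a \<in> O'" "a \<in> carrier G"
    using C openin_subset_carrier by blast
  have "openin T {w \<in> carrier G. a \<otimes> w \<in> O'}"
    using C a by (intro openin_preimage continuous_group_intros) auto
  then obtain W where W: "subgroup W G" "openin T W" "W \<subseteq> {w \<in> carrier G. a \<otimes> w \<in> O'}"
    using compact_open_subgroup a by (metis (no_types, lifting) mem_Collect_eq one_closed r_one)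
  interpret W: subgroup W G by fact
  define M where "M = inv a <# (K \<inter> V B) #> inv (inv a)"
  have KV: "subgroup (K \<inter> V B) G"
    using VB by (simp add: subgroups_Inter_pair K.subgroup_axioms)
  have M: "subgroup M G"
    unfolding M_def using KV a by (intro subgroup_conjugate inv_closed)
  then interpret M: subgroup M G .
  define S where "S = {w \<otimes> m \<otimes> inv w |w m. w \<in> W \<and> m \<in> M}"
  define P where "P = generate G S"
  have SK: "S \<subseteq> K"
  proof
    fix x assume "x \<in> S"
    then obtain w m where wm: "w \<in> W" "m \<in> M" "x = w \<otimes> m \<otimes> inv w"
      by (auto simp: S_def)
    then obtain k where k: "k \<in> K \<inter> V B" "m = inv a \<otimes> k \<otimes> a"
      unfolding M_def l_coset_def r_coset_def inv_inv [OF a(2)] by blast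
    \<comment> \<open>All of \<open>a W\<close> lies in \<open>A B\<close>; applied to
      \<open>a (inv w)\<close>, this says that the conjugate of \<open>m\<close> by \<open>w\<close>
      stays in \<open>K\<close>.\<close>
    have "a \<otimes> inv w \<in> A B"
      using W(3) B(3) wm(1) W.m_inv_closed by blast
    then have "inv (a \<otimes> inv w) \<otimes> k \<otimes> (a \<otimes> inv w) \<in> K"
      using k by (simp add: A_def)
    then show "x \<in> K"
      using wm k a by (simp add: inv_mult_group m_assoc)
  qed
  then have PK: "P \<subseteq> K"
    unfolding P_def using K.subgroup_axioms by (rule generate_subgroup_incl)
  have SG: "S \<subseteq> carrier G"
    using SK K.subset by blast
  have P: "subgroup P G"
    unfolding P_def using SG by (rule generate_is_subgroup)
  then interpret P: subgroup P G .
  have MP: "M \<subseteq> P"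
  proof
    fix m assume "m \<in> M"
    moreover from this have "m = \<one> \<otimes> m \<otimes> inv \<one>" by simp
    ultimately have "m \<in> S"
      using W.one_closed unfolding S_def by blast
    then show "m \<in> P"
      unfolding P_def by (rule generate.incl)
  qed
  have S_conj: "w \<otimes> x \<otimes> inv w \<in> S" if w: "w \<in> W" and x: "x \<in> S" for w x
  proof -
    obtain v m where vm: "v \<in> W" "m \<in> M" "x = v \<otimes> m \<otimes> inv v"
      using x by (auto simp: S_def)
    then have "w \<otimes> x \<otimes> inv w = (w \<otimes> v) \<otimes> m \<otimes> inv (w \<otimes> v)"
      using w by (simp add: inv_mult_group m_assoc)
    then show ?thesis
      using w vm by (auto simp: S_def)
  qed
  have P_conj: "w \<otimes> p \<otimes> inv w \<in> P" if "w \<in> W" "p \<in> P" for w p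
  proof -
    \<comment> \<open>The conjugate of \<open>P\<close> by \<open>inv w\<close> is a subgroup
      containing \<open>S\<close>, hence contains \<open>P\<close>; conjugating back by
      \<open>w\<close> gives the claim.\<close>
    have "inv w <# P #> inv (inv w) \<supseteq> P"
      unfolding P_def
    proof (rule generate_subgroup_incl)
      show "subgroup (inv w <# generate G S #> inv (inv w)) G"
        using P that unfolding P_def by (intro subgroup_conjugate inv_closed) auto
      have "x \<in> inv w <# P #> inv (inv w)" if "x \<in> S" for x
        using S_conj [OF \<open>w \<in> W\<close> that] SG that \<open>w \<in> W\<close>
          mem_conjugate_iff [OF P.subset, of "inv w" x]
        by (auto simp: P_def generate.incl)
      then show "S \<subseteq> inv w <# generate G S #> inv (inv w)"
        by (auto simp: P_def)
    qed
    then show ?thesis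
      using that mem_conjugate_iff [OF P.subset, of "inv w" p] by auto
  qed
  \<comment> \<open>\<open>K\<close> is almost contained in \<open>inv a K a\<close> by
    commensuration, this in \<open>M\<close> by conjugating \<open>K \<inter> V B\<close>, and
    \<open>M\<close> lies in \<open>P\<close>.\<close>
  have "almost_sub K (K \<inter> V B)"
    using K(2) VB K.subset
    by (intro almost_sub_Int compact_almost_sub_open subset_imp_almost_sub K.subgroup_axioms) auto
  then have "almost_sub (inv a <# K #> inv (inv a)) M"
    unfolding M_def using a K.subset by (intro almost_sub_conjugate) auto
  moreover have "almost_sub K (inv a <# K #> inv (inv a))"
    using K(1) a commensurated_iff inv_closed by blast
  ultimately have "almost_sub K M"
    using almost_sub_trans M.subset by blast
  then have "almost_sub K P"
    using almost_sub_trans subset_imp_almost_sub MP P.subset by blast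
  then show ?thesis
    using that [of P W] P PK W P_conj by blast
qed

text \<open>The subgroup \<open>P\<close> inherits commensuration, so its closure is open; being
  compact, \<open>K\<close> is closed and contains that closure.\<close>

lemma simple_compact_commensurated_open:
  assumes "abstractly_simple G" "commensurated G K" "compactin T K" "infinite K"
  shows "openin T K"
proof -
  obtain P W where P: "subgroup P G" "P \<subseteq> K" "almost_sub K P" "subgroup W G" "openin T W"
      "\<And>w p. w \<in> W \<Longrightarrow> p \<in> P \<Longrightarrow> w \<otimes> p \<otimes> inv w \<in> P"
    by (rule compact_commensurated_almost_locally_normal [OF assms(2,3)]) (rule that)
  \<comment> \<open>If \<open>P\<close> were trivial, the finite cover of \<open>K\<close> by its
    cosets would make \<open>K\<close> finite.\<close>
  have "P \<noteq> {\<one>}"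
  proof
    assume "P = {\<one>}"
    with P(3) obtain F where "finite F" "K \<subseteq> {\<one>} <#> F"
      by (auto simp: almost_sub_def)
    then have "finite K"
      by (auto simp: set_mult_def intro: finite_subset)
    then show False
      using assms(4) by simp
  qed
  then have "openin T (T closure_of P)"
    using simple_commensurated_closure_open [OF assms(1) P(4,5) _ _ P(6)]
      commensurated_almost_sub [OF assms(2) P(1-3)] by blast
  moreover have "T closure_of P \<subseteq> K"
    using assms(3) Hausdorff P(2) by (simp add: closure_of_minimal compactin_imp_closedin)
  moreover have "T closure_of P \<noteq> {}"
    using P(1) subgroup.one_closed subgroup.subset
    by (metis closure_of_eq_empty empty_iff topspace_eq_carrier)
  ultimately show ?thesis
    using assms(2) subgroup_openin by (auto simp: commensurated_def)
qed

text \<open>If \<open>K\<close> were finite, \<open>K - {\<one>}\<close> would be closed; removing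
  it from \<open>K\<close> would leave \<open>{\<one>}\<close> open and the group discrete.\<close>

lemma infinite_open_subgroup:
  assumes "T \<noteq> discrete_topology (carrier G)" "subgroup K G" "openin T K"
  shows "infinite K"
proof
  assume "finite K"
  have "closedin T (K - {\<one>})"
    using \<open>finite K\<close> Hausdorff openin_subset_carrier [OF assms(3)]
    by (intro closedin_Hausdorff_finite) (auto simp: topspace_eq_carrier)
  then have "openin T (K - (K - {\<one>}))"
    using assms(3) by (rule openin_diff [rotated])
  moreover have "K - (K - {\<one>}) = {\<one>}"
    using assms(2) subgroup.one_closed by blast
  ultimately show False
    using assms(1) openin_one_imp_discrete by simp
qed

end

text \<open>The last clause asks for \<open>K\<close> non-trivial: the trivial subgroup is
  commensurated and normal in every \<open>U\<close>, but it is closed and, the group being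
  non-discrete, not open.\<close>

theorem theorem3p9:
  fixes G :: "('a, 'b) monoid_scheme" and T :: "'a topology"
  assumes "tdlcsc_group G T"
    and "T \<noteq> discrete_topology (carrier G)"
  shows
    "(abstractly_simple G \<longleftrightarrow>
        (\<forall>N. N \<lhd> G \<and> openin T N \<longrightarrow> N = carrier G) \<and>
        (\<forall>N. N \<lhd> G \<and> N \<noteq> {\<one>\<^bsub>G\<^esub>} \<longrightarrow>
           (\<exists>K\<subseteq>N. subgroup K G \<and> infinite K \<and> commensurated G K \<and> compactin T K
                \<and> locally_normal G T K)) \<and>
        (\<forall>K. subgroup K G \<and> infinite K \<and> commensurated G K \<and> compactin T K \<longrightarrow> openin T K))
     \<and> (abstractly_simple G \<longrightarrow>
        (\<forall>U K. subgroup U G \<and> openin T U \<and> K \<lhd> G\<lparr>carrier := U\<rparr> \<and> commensurated G K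
             \<and> K \<noteq> {\<one>\<^bsub>G\<^esub>} \<longrightarrow>
           countable (rcosets\<^bsub>G\<^esub> K) \<and> subgroup (T closure_of K) G \<and> openin T (T closure_of K)))"
    (is "(?simple \<longleftrightarrow> ?S0 \<and> ?S1 \<and> ?S2) \<and> (_ \<longrightarrow> ?strong)")
proof -
  interpret tdlcsc_group G T by fact
  have S0: ?S0 if simple: ?simple
  proof (intro allI impI)
    fix N assume N: "N \<lhd> G \<and> openin T N"
    then have "N \<noteq> {\<one>\<^bsub>G\<^esub>}"
      using assms(2) openin_one_imp_discrete by blast
    then show "N = carrier G"
      using simple N by (auto simp: abstractly_simple_def)
  qed
  have S1: ?S1 if simple: ?simple
  proof (intro allI impI)
    fix N assume N: "N \<lhd> G \<and> N \<noteq> {\<one>\<^bsub>G\<^esub>}"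
    \<comment> \<open>As \<open>N\<close> is all of \<open>G\<close>, any compact open subgroup
      serves as the witness.\<close>
    then have "N = carrier G"
      using simple by (auto simp: abstractly_simple_def)
    moreover obtain V where "subgroup V G" "openin T V" "compactin T V" "V \<subseteq> carrier G"
      using compact_open_subgroup [of "carrier G"] topspace_eq_carrier openin_topspace one_closed
      by metis
    ultimately show "\<exists>K\<subseteq>N. subgroup K G \<and> infinite K \<and> commensurated G K \<and> compactin T K
        \<and> locally_normal G T K"
      using infinite_open_subgroup [OF assms(2)] compact_open_subgroup_commensurated
        open_subgroup_locally_normal by blast
  qed
  have S2: ?S2 if ?simple
    using simple_compact_commensurated_open [OF that] by blast
  have simple: ?simple if "?S0 \<and> ?S1 \<and> ?S2"
    unfolding abstractly_simple_def
  proof (intro allI impI)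
    fix N assume N: "N \<lhd> G"
    have "N = carrier G" if "N \<noteq> {\<one>\<^bsub>G\<^esub>}"
    proof -
      \<comment> \<open>(S1) supplies a compact commensurated \<open>K\<close> inside
        \<open>N\<close>, and (S2) makes it open.\<close>
      obtain K where K: "K \<subseteq> N" "subgroup K G" "openin T K"
        using \<open>?S0 \<and> ?S1 \<and> ?S2\<close> N \<open>N \<noteq> {\<one>\<^bsub>G\<^esub>}\<close> by meson
      then have "openin T N"
        using N subgroup_openin [of N K] normal_imp_subgroup subgroup.one_closed by blast
      then show ?thesis
        using \<open>?S0 \<and> ?S1 \<and> ?S2\<close> N by blast
    qed
    then show "N = carrier G \<or> N = {\<one>\<^bsub>G\<^esub>}"
      by blast
  qed
  have strong: ?strong if simple: ?simple
  proof (intro allI impI, elim conjE)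
    fix U K
    assume U: "subgroup U G" "openin T U" and K: "K \<lhd> G\<lparr>carrier := U\<rparr>"
      and com: "commensurated G K" and nontriv: "K \<noteq> {\<one>\<^bsub>G\<^esub>}"
    \<comment> \<open>Normality of \<open>K\<close> in \<open>U\<close> uses the inverse of the
      restricted group, which agrees with that of \<open>G\<close> on \<open>U\<close>.\<close>
    have "u \<otimes>\<^bsub>G\<^esub> k \<otimes>\<^bsub>G\<^esub> inv\<^bsub>G\<^esub> u \<in> K" if "u \<in> U" "k \<in> K" for u k
      using normal.inv_op_closed2 [OF K, of u k] that m_inv_consistent [OF U(1)] by simp
    then show "countable (rcosets\<^bsub>G\<^esub> K) \<and> subgroup (T closure_of K) G \<and> openin T (T closure_of K)"
      using simple_commensurated_closure_open [OF simple U com nontriv] com subgroup_closure_of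
      by (simp add: commensurated_def)
  qed
  show ?thesis
    using S0 S1 S2 simple strong by blast
qed

end
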